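(* Let $\mathcal K=H_1\oplus\cdots\oplus H_m$ be a real Hilbert space with a finite orthogonal decomposition into closed subspaces. Let $\Phi\in\Gamma_0(\mathcal K)$ and $T=\operatorname{prox}_\Phi$. Let $C_1,\dots,C_r$ be the connected components of the exact dependency graph of $T$ with respect to this decomposition, and let $K_\alpha=\bigoplus_{i\in C_\alpha}H_i$. Then there exist $\phi_\alpha\in\Gamma_0(K_\alpha)$ ($1\le\alpha\le r$) and $C\in\mathbb R$ such that $$\Phi(x)=C+\sum_{\alpha=1}^r\phi_\alpha(P_{K_\alpha}x)\qquad\forall x\in\mathcal K.$$ Conversely, any decomposition of $\Phi$ of this form (with $\phi_\alpha\in\Gamma_0(K_\alpha)$ and $C\in\mathbb R$) makes $\operatorname{prox}_\Phi$ block diagonal across the $K_\alpha$, i.e. for each $\alpha$, $P_{K_\alpha}\operatorname{prox}_\Phi(x)$ depends only on $P_{K_\alpha}x$.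
   Context: $\Gamma_0(\mathcal K)$ denotes the proper lower-semicontinuous convex functions $\Phi:\mathcal K\to\mathbb R\cup\{+\infty\}$. For $\Phi\in\Gamma_0(\mathcal K)$, $\operatorname{prox}_\Phi(x)$ is the unique minimizer over $y\in\mathcal K$ of $\tfrac12\|x-y\|^2+\Phi(y)$. $P_M$ is the orthogonal projection onto a closed subspace $M$. For a map $T:\mathcal K\to\mathcal K$ and closed subspaces $M,N$, write $M\not\rightsquigarrow_T N$ if $P_NT(x+h)=P_NT(x)$ for all $x\in\mathcal K$, $h\in M$. The exact dependency digraph of $T$ has vertex set $\{1,\dots,m\}$ and, for $i\ne j$, an edge $i\to j$ exactly when $H_i\not\rightsquigarrow_TH_j$ fails. For $T=\operatorname{prox}_\Phi$ (which is the gradient of a $C^1$ function) this digraph is symmetric and is regarded as an undirected graph, the exact dependency graph. *)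

theory Defs
  imports "Graph_Theory.Digraph_Component" "HOL-Analysis.Analysis"
begin

text \<open>
  A real Hilbert space is a type of sort \<open>{real_inner, complete_space}\<close>.
  Extended-valued functions on a closed subspace \<open>M\<close> are total functions \<open>'a \<Rightarrow> ereal\<close>
  of which only the values on \<open>M\<close> matter.
\<close>

text \<open>The members of \<open>Gamma0 M\<close> are the proper lower-semicontinuous convex functions
  from \<open>M\<close> to the reals extended by \<open>\<infinity>\<close>. The limit inferior is relative to \<open>M\<close>
  and runs over points other than \<open>x\<close>, which for the inequality makes no difference.\<close>

definition Gamma0 :: "'a::real_inner set \<Rightarrow> ('a \<Rightarrow> ereal) set" where
  "Gamma0 M = {f.
     (\<forall>x\<in>M. f x \<noteq> - \<infinity>) \<and>
     (\<exists>x\<in>M. f x \<noteq> \<infinity>) \<and>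
     (\<forall>x\<in>M. f x \<le> Liminf (at x within M) f) \<and>
     (\<forall>x\<in>M. \<forall>y\<in>M. \<forall>t. 0 < t \<and> t < 1 \<longrightarrow>
        f ((1 - t) *\<^sub>R x + t *\<^sub>R y) \<le> ereal (1 - t) * f x + ereal t * f y)}"

definition prox :: "('a::real_inner \<Rightarrow> ereal) \<Rightarrow> 'a \<Rightarrow> 'a" where
  "prox \<Phi> x = (THE p. is_arg_min (\<lambda>y. ereal (1 / 2 * (norm (x - y))\<^sup>2) + \<Phi> y) (\<lambda>_. True) p)"

definition orth_proj :: "'a::real_inner set \<Rightarrow> 'a \<Rightarrow> 'a" where
  "orth_proj M x = (THE p. p \<in> M \<and> x - p \<in> M\<^sup>\<bottom>)"

definition subspace_sum :: "'i set \<Rightarrow> ('i \<Rightarrow> 'a::real_vector set) \<Rightarrow> 'a set" where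
  "subspace_sum I H = {\<Sum>i\<in>I. h i | h. \<forall>i\<in>I. h i \<in> H i}"

definition orth_decomposition :: "nat \<Rightarrow> (nat \<Rightarrow> 'a::real_inner set) \<Rightarrow> bool" where
  "orth_decomposition m H \<longleftrightarrow>
     (\<forall>i\<in>{1..m}. subspace (H i) \<and> closed (H i)) \<and>
     (\<forall>i\<in>{1..m}. \<forall>j\<in>{1..m}. i \<noteq> j \<longrightarrow> (\<forall>x\<in>H i. \<forall>y\<in>H j. orthogonal x y)) \<and>
     subspace_sum {1..m} H = UNIV"

definition indep_of :: "('a::real_inner \<Rightarrow> 'a) \<Rightarrow> 'a set \<Rightarrow> 'a set \<Rightarrow> bool" where
  "indep_of T M N \<longleftrightarrow> (\<forall>x. \<forall>h\<in>M. orth_proj N (T (x + h)) = orth_proj N (T x))"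

definition dependency_digraph ::
    "nat \<Rightarrow> (nat \<Rightarrow> 'a::real_inner set) \<Rightarrow> ('a \<Rightarrow> 'a) \<Rightarrow> nat pair_pre_digraph" where
  "dependency_digraph m H T =
     \<lparr> pverts = {1..m},
       parcs = {(i, j). i \<in> {1..m} \<and> j \<in> {1..m} \<and> i \<noteq> j \<and> \<not> indep_of T (H i) (H j)} \<rparr>"

text \<open>The digraph is regarded as undirected by passing to its symmetrization, which does not
  change it when it is already symmetric (as for a proximal map). The strongly connected
  components of a symmetric digraph are the connected components of the undirected graph;
  each component is given by its vertex set.\<close>

definition dependency_components ::
    "nat \<Rightarrow> (nat \<Rightarrow> 'a::real_inner set) \<Rightarrow> ('a \<Rightarrow> 'a) \<Rightarrow> nat set set" where
  "dependency_components m H T =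
     pre_digraph.sccs_verts (with_proj (mk_symmetric (with_proj (dependency_digraph m H T))))"

end

theory Submission
  imports Defs
begin

text \<open>
  Let \<open>T = prox \<Phi>\<close>. The theorem is an instance of an equivalence that holds for every finite
  orthogonal decomposition into subspaces: \<open>\<Phi>\<close> is a constant plus a sum of functions of the single
  blocks exactly if \<open>T\<close> is block diagonal. The components of the dependency graph enter only through
  the fact that merging the subspaces in each component makes \<open>T\<close> block diagonal
  (\<open>indep_of_outside_component\<close>, \<open>indep_imp_block_depends_only_on_block\<close>).

  Let \<open>T\<close> be block diagonal and let \<open>g\<close> be \<open>1 / 2 * (norm x)\<^sup>2\<close> minus the Moreau envelope of \<open>\<Phi>\<close>.
  This is a convex function with gradient \<open>T\<close>. If \<open>h\<close> lies in one block, then the slope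
  of \<open>g\<close> in direction \<open>h\<close> sees only this block, both of \<open>T\<close> and of the base point; so \<open>g\<close> is,
  up to a constant, the sum of its restrictions to the blocks (\<open>prox_potential_additive\<close>).
  On the other hand \<open>g\<close> is the conjugate of \<open>\<Phi> + 1 / 2 * (norm _)\<^sup>2\<close>, and by biconjugation
  \<open>\<Phi>\<close> is recovered as \<open>\<Phi> y = (SUP x. inner x y - g x) - 1 / 2 * (norm y)\<^sup>2\<close>
  (\<open>Fenchel_Young\<close>, \<open>potential_approximates\<close>). All terms are sums over the blocks of \<open>x\<close> and \<open>y\<close>, so
  the supremum splits, and its parts are the functions \<open>\<phi>\<close>
  (\<open>block_diagonal_prox_imp_separable\<close>). They are convex and lower semicontinuous because each
  agrees, up to a constant, with \<open>\<Phi>\<close> on a translate of the block through a point of the domain.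

  Conversely, for separable \<open>\<Phi>\<close> the subgradient inequality that characterizes \<open>T\<close> may be
  tested with changes of a single block. The \<open>i\<close>-th component of \<open>T x\<close> is thereby the proximal
  point, for \<open>\<phi> i\<close>, of the \<open>i\<close>-th component of \<open>x\<close>, and so it depends on nothing else
  (\<open>separable_imp_block_diagonal_prox\<close>).

  Everything rests on the existence of points \<open>p\<close> at which \<open>c *\<^sub>R (x - p)\<close> is a subgradient
  (\<open>resolvent_exists\<close>), which comes from strong convexity and completeness. It also replaces the
  Hahn-Banach theorem in the proof of the biconjugation formula.
\<close>

section \<open>Proper lower-semicontinuous convex functions\<close>

lemma le_Liminf_within_iff:
  fixes f :: "'a::metric_space \<Rightarrow> ereal"
  shows "f x \<le> Liminf (at x within M) f \<longleftrightarrow>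
    (\<forall>s<f x. \<exists>d>0. \<forall>y\<in>M. dist y x < d \<longrightarrow> s < f y)"
proof -
  have "(\<forall>\<^sub>F y in at x within M. s < f y) \<longleftrightarrow> (\<exists>d>0. \<forall>y\<in>M. dist y x < d \<longrightarrow> s < f y)"
    if "s < f x" for s
    unfolding eventually_at using that by metis
  then show ?thesis
    unfolding le_Liminf_iff by blast
qed

lemma Gamma0_lsc:
  assumes "f \<in> Gamma0 M" "x \<in> M" "s < f x"
  obtains d where "d > 0" "\<And>y. y \<in> M \<Longrightarrow> dist y x < d \<Longrightarrow> s < f y"
proof -
  have "f x \<le> Liminf (at x within M) f"
    using assms by (auto simp: Gamma0_def)
  with assms(3) show ?thesis
    unfolding le_Liminf_within_iff using that by blast
qed

lemma Gamma0_real_convex: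
  assumes "\<Phi> \<in> Gamma0 UNIV" "\<Phi> x = ereal a" "\<Phi> y = ereal b" "0 < t" "t < 1"
  obtains c where "\<Phi> ((1 - t) *\<^sub>R x + t *\<^sub>R y) = ereal c" "c \<le> (1 - t) * a + t * b"
proof -
  have le: "\<Phi> ((1 - t) *\<^sub>R x + t *\<^sub>R y) \<le> ereal ((1 - t) * a + t * b)"
  proof -
    have "\<Phi> ((1 - t) *\<^sub>R x + t *\<^sub>R y) \<le> ereal (1 - t) * \<Phi> x + ereal t * \<Phi> y"
      using assms(1,4,5) unfolding Gamma0_def by blast
    then show ?thesis
      by (simp add: assms(2,3))
  qed
  have "\<Phi> ((1 - t) *\<^sub>R x + t *\<^sub>R y) \<noteq> - \<infinity>"
    using assms(1) by (simp add: Gamma0_def)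
  with le obtain c where "\<Phi> ((1 - t) *\<^sub>R x + t *\<^sub>R y) = ereal c"
    by (cases "\<Phi> ((1 - t) *\<^sub>R x + t *\<^sub>R y)") auto
  with le that show ?thesis
    by simp
qed

lemma Gamma0_not_minus_infty: "\<Phi> \<in> Gamma0 UNIV \<Longrightarrow> \<Phi> x \<noteq> - \<infinity>"
  by (simp add: Gamma0_def)

lemma Gamma0_proper:
  assumes "\<Phi> \<in> Gamma0 UNIV"
  obtains z r where "\<Phi> z = ereal r"
proof -
  from assms obtain z where "\<Phi> z \<noteq> \<infinity>" "\<Phi> z \<noteq> - \<infinity>"
    by (auto simp: Gamma0_def)
  then show ?thesis
    using that by (cases "\<Phi> z") auto
qed

text \<open>
  Each summand of the decomposition will turn out to be \<open>\<Phi>\<close> restricted to a translate of a block,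
  up to a real constant, and this is how it inherits membership in \<open>Gamma0\<close>.
\<close>

lemma Gamma0_restrict_translate:
  fixes \<Phi> :: "'a::real_inner \<Rightarrow> ereal"
  assumes \<Phi>: "\<Phi> \<in> Gamma0 UNIV" and M: "subspace M"
    and f: "\<And>v. v \<in> M \<Longrightarrow> f v = \<Phi> (v + w) + ereal k"
    and z: "z \<in> M" "\<Phi> (z + w) \<noteq> \<infinity>"
  shows "f \<in> Gamma0 M"
proof -
  have nm: "\<Phi> y \<noteq> - \<infinity>" for y
    using \<Phi> by (rule Gamma0_not_minus_infty)
  have "f x \<noteq> - \<infinity>" if "x \<in> M" for x
    using nm[of "x + w"] f[OF that] by (cases "\<Phi> (x + w)") auto
  moreover have "\<exists>x\<in>M. f x \<noteq> \<infinity>"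
    using z f[OF z(1)] nm[of "z + w"] by (intro bexI[OF _ z(1)], cases "\<Phi> (z + w)") auto
  moreover have "f x \<le> Liminf (at x within M) f" if x: "x \<in> M" for x
    unfolding le_Liminf_within_iff
  proof (intro allI impI)
    fix s assume "s < f x"
    then have "s - ereal k < \<Phi> (x + w)"
      unfolding f[OF x] by (cases s; cases "\<Phi> (x + w)") auto
    then obtain d where d: "d > 0" "\<And>y. dist y (x + w) < d \<Longrightarrow> s - ereal k < \<Phi> y"
      using Gamma0_lsc[OF \<Phi>] by (metis UNIV_I)
    have "s < f y" if "y \<in> M" "dist y x < d" for y
    proof -
      have "s - ereal k < \<Phi> (y + w)"
        using d(2)[of "y + w"] that by simp
      then show ?thesis
        unfolding f[OF that(1)] by (cases s; cases "\<Phi> (y + w)") auto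
    qed
    with d(1) show "\<exists>d>0. \<forall>y\<in>M. dist y x < d \<longrightarrow> s < f y"
      by blast
  qed
  moreover have "f ((1 - t) *\<^sub>R x + t *\<^sub>R y) \<le> ereal (1 - t) * f x + ereal t * f y"
    if xy: "x \<in> M" "y \<in> M" and t: "0 < t" "t < 1" for x y t
  proof -
    have m: "(1 - t) *\<^sub>R x + t *\<^sub>R y \<in> M"
      using xy M by (simp add: subspace_add subspace_scale)
    have eq: "(1 - t) *\<^sub>R x + t *\<^sub>R y + w = (1 - t) *\<^sub>R (x + w) + t *\<^sub>R (y + w)"
      by (simp add: algebra_simps)
    show ?thesis
    proof (cases "\<Phi> (x + w) = \<infinity> \<or> \<Phi> (y + w) = \<infinity>")
      case True
      have "f x \<noteq> - \<infinity>" "f y \<noteq> - \<infinity>" "f x = \<infinity> \<or> f y = \<infinity>"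
        using True nm[of "x + w"] nm[of "y + w"] f xy
        by (cases "\<Phi> (x + w)"; cases "\<Phi> (y + w)"; auto)+
      then have "ereal (1 - t) * f x + ereal t * f y = \<infinity>"
        using t by (cases "f x"; cases "f y") auto
      then show ?thesis
        by (metis ereal_less_eq(1))
    next
      case False
      then obtain a b where ab: "\<Phi> (x + w) = ereal a" "\<Phi> (y + w) = ereal b"
        using nm by (metis ereal_cases)
      obtain c where c: "\<Phi> ((1 - t) *\<^sub>R (x + w) + t *\<^sub>R (y + w)) = ereal c" "c \<le> (1 - t) * a + t * b"
        using Gamma0_real_convex[OF \<Phi> ab t] .
      have "c + k \<le> (1 - t) * (a + k) + t * (b + k)"
        using c(2) by (simp add: algebra_simps)
      then show ?thesis
        using f[OF m] f[OF xy(1)] f[OF xy(2)] ab c(1) unfolding eq by simp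
    qed
  qed
  ultimately show ?thesis
    by (auto simp: Gamma0_def)
qed

section \<open>Subgradients and the proximal map\<close>

text \<open>
  The finiteness of \<open>\<Phi> p\<close> is part of the notion, so that subgradient inequalities can be added
  and subtracted as inequalities between reals.
\<close>

definition subgradient :: "('a::real_inner \<Rightarrow> ereal) \<Rightarrow> 'a \<Rightarrow> 'a \<Rightarrow> bool" where
  "subgradient \<Phi> p u \<longleftrightarrow> \<bar>\<Phi> p\<bar> \<noteq> \<infinity> \<and> (\<forall>y. \<Phi> p + ereal (inner u (y - p)) \<le> \<Phi> y)"

lemma subgradientE:
  assumes "subgradient \<Phi> p u"
  obtains r where "\<Phi> p = ereal r" "\<And>y. ereal (r + inner u (y - p)) \<le> \<Phi> y"
  using assms unfolding subgradient_def by (metis abs_ereal.simps(2,3) ereal_cases plus_ereal.simps(1))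

text \<open>
  Near a point \<open>z\<close> of the domain lower semicontinuity bounds \<open>\<Phi>\<close> below by \<open>\<Phi> z - 1\<close>. A point far
  from \<open>z\<close> is joined to \<open>z\<close> by a segment that meets this neighbourhood, and convexity along the
  segment lets \<open>\<Phi>\<close> decrease at most linearly. This elementary bound takes the place of the
  affine minorant from the Hahn-Banach theorem; it is enough against a quadratic penalty.
\<close>

lemma Gamma0_linear_minorant:
  assumes \<Phi>: "\<Phi> \<in> Gamma0 UNIV"
  obtains a b where "b \<ge> 0" "\<And>y. ereal (a - b * norm (y - x)) \<le> \<Phi> y"
proof -
  obtain z r where z: "\<Phi> z = ereal r"
    using Gamma0_proper[OF \<Phi>] .
  have "ereal (r - 1) < \<Phi> z"
    using z by simp
  then obtain d where d: "d > 0" "\<And>y. dist y z < d \<Longrightarrow> ereal (r - 1) < \<Phi> y"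
    using Gamma0_lsc[OF \<Phi>] by (metis UNIV_I)
  have key: "ereal (r - 1 - 2 / d * norm (y - z)) \<le> \<Phi> y" for y
  proof (cases "norm (y - z) < d")
    case True
    have "ereal (r - 1 - 2 / d * norm (y - z)) \<le> ereal (r - 1)"
      using d(1) by simp
    also have "\<dots> \<le> \<Phi> y"
      using d(2)[of y] True by (simp add: dist_norm)
    finally show ?thesis .
  next
    case False
    show ?thesis
    proof (cases "\<Phi> y")
      case (real s)
      \<comment> \<open>The point of the segment at distance \<open>d / 2\<close> from \<open>z\<close> lies in the ball.\<close>
      define t where "t = d / (2 * norm (y - z))"
      have n: "norm (y - z) > 0"
        using False d(1) by linarith
      have t: "0 < t" "t < 1" "1 / t = 2 / d * norm (y - z)"
        using False d(1) n by (auto simp: t_def field_simps)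
      obtain c where c: "\<Phi> ((1 - t) *\<^sub>R z + t *\<^sub>R y) = ereal c" "c \<le> (1 - t) * r + t * s"
        using Gamma0_real_convex[OF \<Phi> z real t(1,2)] .
      have "(1 - t) *\<^sub>R z + t *\<^sub>R y - z = t *\<^sub>R (y - z)"
        by (simp add: algebra_simps)
      then have "dist ((1 - t) *\<^sub>R z + t *\<^sub>R y) z = t * norm (y - z)"
        using t by (simp add: dist_norm)
      also have "\<dots> = d / 2"
        using False d(1) by (auto simp: t_def)
      finally have "r - 1 < c"
        using d(2)[of "(1 - t) *\<^sub>R z + t *\<^sub>R y"] c(1) d(1) by simp
      with c(2) have "t * (r - s) < 1"
        by (simp add: algebra_simps)
      then have "r - s < 1 / t"
        using t(1) by (simp add: field_simps)
      then show ?thesis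
        using real t(3) by simp
    qed (use Gamma0_not_minus_infty[OF \<Phi>] in auto)
  qed
  show ?thesis
  proof (rule that[of "2 / d" "r - 1 - 2 / d * norm (x - z)"])
    show "2 / d \<ge> 0"
      using d(1) by simp
    fix y
    have "norm (y - z) \<le> norm (y - x) + norm (x - z)"
      by (metis diff_add_cancel add_diff_eq norm_triangle_ineq)
    then have "2 / d * norm (y - z) \<le> 2 / d * (norm (y - x) + norm (x - z))"
      using d(1) by (intro mult_left_mono) auto
    then have "r - 1 - 2 / d * norm (x - z) - 2 / d * norm (y - x) \<le> r - 1 - 2 / d * norm (y - z)"
      by (simp add: algebra_simps)
    then show "ereal (r - 1 - 2 / d * norm (x - z) - 2 / d * norm (y - x)) \<le> \<Phi> y"
      using key[of y] by (meson ereal_less_eq(3) order_trans)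
  qed
qed

lemma norm_midpoint_identity:
  fixes x y z :: "'a::real_inner"
  shows "(norm (x - ((1/2) *\<^sub>R y + (1/2) *\<^sub>R z)))\<^sup>2 =
    (norm (x - y))\<^sup>2 / 2 + (norm (x - z))\<^sup>2 / 2 - (norm (y - z))\<^sup>2 / 4"
  by (simp add: power2_norm_eq_inner inner_diff inner_add inner_commute field_simps)

lemma norm_diff_scaled_sq:
  fixes x p y :: "'a::real_inner"
  shows "(norm (x - ((1 - t) *\<^sub>R p + t *\<^sub>R y)))\<^sup>2 =
    (norm (x - p))\<^sup>2 - 2 * t * inner (x - p) (y - p) + t\<^sup>2 * (norm (y - p))\<^sup>2"
proof -
  have eq: "x - ((1 - t) *\<^sub>R p + t *\<^sub>R y) = (x - p) - t *\<^sub>R (y - p)"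
    by (simp add: algebra_simps)
  have "(norm (a - t *\<^sub>R b))\<^sup>2 = (norm a)\<^sup>2 - 2 * t * inner a b + t\<^sup>2 * (norm b)\<^sup>2" for a b :: 'a
    unfolding power2_norm_eq_inner
    by (simp add: inner_diff inner_commute algebra_simps power2_eq_square[of t])
  then show ?thesis
    unfolding eq .
qed

text \<open>
  The first-order condition for a minimizer of \<open>c / 2 * (norm (x - y))\<^sup>2 + \<Phi> y\<close>: compare \<open>p\<close> with the
  point at parameter \<open>t\<close> on the segment to \<open>y\<close>, divide by \<open>t\<close> and let \<open>t\<close> tend to 0.
\<close>

lemma subgradient_of_minimizer:
  assumes \<Phi>: "\<Phi> \<in> Gamma0 UNIV" and p: "\<Phi> p = ereal r"
    and min: "\<And>y s. \<Phi> y = ereal s \<Longrightarrow> c / 2 * (norm (x - p))\<^sup>2 + r \<le> c / 2 * (norm (x - y))\<^sup>2 + s"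
  shows "subgradient \<Phi> p (c *\<^sub>R (x - p))"
proof -
  have "ereal (r + c * inner (x - p) (y - p)) \<le> \<Phi> y" for y
  proof (cases "\<Phi> y")
    case (real s)
    have ineq: "r + c * inner (x - p) (y - p) \<le> s + t * (c / 2 * (norm (y - p))\<^sup>2)"
      if t: "0 < t" "t < 1" for t
    proof -
      obtain q where q: "\<Phi> ((1 - t) *\<^sub>R p + t *\<^sub>R y) = ereal q" "q \<le> (1 - t) * r + t * s"
        using Gamma0_real_convex[OF \<Phi> p real t] .
      have "t * (r + c * inner (x - p) (y - p)) \<le> t * (s + t * (c / 2 * (norm (y - p))\<^sup>2))"
        using min[OF q(1)] q(2) unfolding norm_diff_scaled_sq
        by (simp add: algebra_simps power2_eq_square)
      then show ?thesis
        using t by simp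
    qed
    have "((\<lambda>t. s + t * (c / 2 * (norm (y - p))\<^sup>2)) \<longlongrightarrow> s + 0 * (c / 2 * (norm (y - p))\<^sup>2))
        (at_right 0)"
      by (intro tendsto_intros)
    moreover have "\<forall>\<^sub>F t in at_right 0.
        r + c * inner (x - p) (y - p) \<le> s + t * (c / 2 * (norm (y - p))\<^sup>2)"
      unfolding eventually_at_right_field using ineq by (meson zero_less_one)
    ultimately have "r + c * inner (x - p) (y - p) \<le> s + 0 * (c / 2 * (norm (y - p))\<^sup>2)"
      using tendsto_lowerbound trivial_limit_at_right_real by blast
    then show ?thesis
      using real by simp
  qed (use Gamma0_not_minus_infty[OF \<Phi>] in auto)
  then show ?thesis
    using p by (simp add: subgradient_def)
qed

text \<open>
  A minimizing sequence of the strongly convex function \<open>c / 2 * (norm (x - y))\<^sup>2 + \<Phi> y\<close> is Cauchy, and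
  by lower semicontinuity its limit is a minimizer. The case \<open>c = 1\<close> gives the proximal map; large
  \<open>c\<close> serves to approximate \<open>x\<close> by points with a subgradient.
\<close>

lemma resolvent_exists:
  fixes \<Phi> :: "'a::{real_inner, complete_space} \<Rightarrow> ereal"
  assumes \<Phi>: "\<Phi> \<in> Gamma0 UNIV" and c: "c > 0"
  obtains p where "subgradient \<Phi> p (c *\<^sub>R (x - p))"
proof -
  define V where "V = {c / 2 * (norm (x - y))\<^sup>2 + s | y s. \<Phi> y = ereal s}"
  define m where "m = Inf V"
  obtain a b where ab: "b \<ge> 0" "\<And>y. ereal (a - b * norm (y - x)) \<le> \<Phi> y"
    using Gamma0_linear_minorant[OF \<Phi>, where x = x] by metis
  have "a - b\<^sup>2 / (2 * c) \<le> v" if "v \<in> V" for v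
  proof -
    from that obtain y s where ys: "\<Phi> y = ereal s" "v = c / 2 * (norm (x - y))\<^sup>2 + s"
      by (auto simp: V_def)
    have "a - b * norm (x - y) \<le> s"
      using ab(2)[of y] ys(1) by (simp add: norm_minus_commute)
    moreover have "0 \<le> (c * norm (x - y) - b)\<^sup>2 / (2 * c)"
      using c by simp
    then have "b * norm (x - y) \<le> c / 2 * (norm (x - y))\<^sup>2 + b\<^sup>2 / (2 * c)"
      using c by (simp add: field_simps power2_eq_square)
    ultimately show ?thesis
      using ys(2) by linarith
  qed
  then have bdd: "bdd_below V"
    by (auto simp: bdd_below_def)
  have ne: "V \<noteq> {}"
    by (rule Gamma0_proper[OF \<Phi>]) (auto simp: V_def)
  have lower: "m \<le> c / 2 * (norm (x - y))\<^sup>2 + s" if "\<Phi> y = ereal s" for y s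
    unfolding m_def by (rule cInf_lower[OF _ bdd]) (use that in \<open>auto simp: V_def\<close>)
  have "\<exists>y s. \<Phi> y = ereal s \<and> c / 2 * (norm (x - y))\<^sup>2 + s < m + 1 / Suc n" for n
  proof -
    have "Inf V < m + 1 / Suc n"
      by (simp add: m_def)
    then show ?thesis
      using cInf_lessD[OF ne] by (fastforce simp: V_def)
  qed
  then obtain Y S where YS: "\<And>n. \<Phi> (Y n) = ereal (S n)"
      "\<And>n. c / 2 * (norm (x - Y n))\<^sup>2 + S n < m + 1 / Suc n"
    by metis
  \<comment> \<open>Strong convexity: the midpoint of two nearly minimal points would be better than \<open>m\<close>
    if they were far apart.\<close>
  have gap: "c / 8 * (norm (Y i - Y j))\<^sup>2 \<le> (1 / Suc i + 1 / Suc j) / 2" for i j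
  proof -
    obtain q where q: "\<Phi> ((1 - 1/2) *\<^sub>R Y i + (1/2) *\<^sub>R Y j) = ereal q"
        "q \<le> (1 - 1/2) * S i + 1/2 * S j"
      using Gamma0_real_convex[OF \<Phi> YS(1) YS(1), of "1/2" i j] by auto
    show ?thesis
      using lower[OF q(1)] q(2) YS(2)[of i] YS(2)[of j] norm_midpoint_identity[of x "Y i" "Y j"]
      by (simp add: algebra_simps)
  qed
  have "Cauchy Y"
  proof (rule metric_CauchyI)
    fix e :: real assume e: "e > 0"
    obtain N where N: "1 / Suc N < c / 8 * e\<^sup>2"
      using nat_approx_posE[of "c / 8 * e\<^sup>2"] e c by auto
    have "dist (Y i) (Y j) < e" if "i \<ge> N" "j \<ge> N" for i j
    proof -
      have "1 / Suc i \<le> 1 / Suc N" "1 / Suc j \<le> 1 / Suc N"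
        using that by (auto simp: frac_le)
      then have "(1 / Suc i + 1 / Suc j) / 2 \<le> 1 / Suc N"
        by argo
      then have "c / 8 * (norm (Y i - Y j))\<^sup>2 < c / 8 * e\<^sup>2"
        using gap[of i j] N by argo
      then have "(norm (Y i - Y j))\<^sup>2 < e\<^sup>2"
        using c by simp
      then show ?thesis
        using e by (simp add: dist_norm power_less_imp_less_base)
    qed
    then show "\<exists>N. \<forall>i\<ge>N. \<forall>j\<ge>N. dist (Y i) (Y j) < e"
      by blast
  qed
  then obtain p where lim: "Y \<longlonglongrightarrow> p"
    using Cauchy_convergent_iff convergent_def by blast
  have le: "\<Phi> p \<le> ereal (m - c / 2 * (norm (x - p))\<^sup>2)"
  proof (rule ccontr)
    assume "\<not> ?thesis"
    then obtain s where s: "m - c / 2 * (norm (x - p))\<^sup>2 < s" "ereal s < \<Phi> p"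
      by (metis ereal_dense2 less_ereal.simps(1) linorder_not_le)
    obtain d where d: "d > 0" "\<And>y. dist y p < d \<Longrightarrow> ereal s < \<Phi> y"
      using Gamma0_lsc[OF \<Phi> _ s(2)] by (metis UNIV_I)
    have "\<forall>\<^sub>F n in sequentially. dist (Y n) p < d"
      using lim d(1) tendstoD by blast
    then have ev: "\<forall>\<^sub>F n in sequentially. s + c / 2 * (norm (x - Y n))\<^sup>2 \<le> m + 1 / Suc n"
    proof eventually_elim
      case (elim n)
      then show ?case
        using d(2)[of "Y n"] YS(1)[of n] YS(2)[of n] by simp
    qed
    have l1: "(\<lambda>n. s + c / 2 * (norm (x - Y n))\<^sup>2) \<longlonglongrightarrow> s + c / 2 * (norm (x - p))\<^sup>2"
      by (intro tendsto_intros lim)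
    have l2: "(\<lambda>n. m + 1 / Suc n) \<longlonglongrightarrow> m + 0"
      by (intro tendsto_intros LIMSEQ_Suc[OF lim_1_over_n])
    have "s + c / 2 * (norm (x - p))\<^sup>2 \<le> m + 0"
      using tendsto_le[OF _ l2 l1 ev] by simp
    then show False
      using s(1) by simp
  qed
  then obtain r where r: "\<Phi> p = ereal r"
    using Gamma0_not_minus_infty[OF \<Phi>, of p] by (cases "\<Phi> p") auto
  have "subgradient \<Phi> p (c *\<^sub>R (x - p))"
  proof (rule subgradient_of_minimizer[OF \<Phi> r])
    fix y s assume "\<Phi> y = ereal s"
    then show "c / 2 * (norm (x - p))\<^sup>2 + r \<le> c / 2 * (norm (x - y))\<^sup>2 + s"
      using lower[of y s] le r by simp
  qed
  then show ?thesis
    using that by blast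
qed

text \<open>
  A subgradient \<open>x - p\<close> at \<open>p\<close> makes the proximal objective exceed its value at \<open>p\<close> by at least
  \<open>1 / 2 * (norm (y - p))\<^sup>2\<close>, so that \<open>p\<close> is its only minimizer.
\<close>

lemma prox_eqI:
  assumes "subgradient \<Phi> p (x - p)"
  shows "prox \<Phi> x = p"
proof -
  obtain r where r: "\<Phi> p = ereal r" "\<And>y. ereal (r + inner (x - p) (y - p)) \<le> \<Phi> y"
    using subgradientE[OF assms] by metis
  define F where "F y = ereal (1 / 2 * (norm (x - y))\<^sup>2) + \<Phi> y" for y
  have strong: "F p + ereal (1 / 2 * (norm (y - p))\<^sup>2) \<le> F y" for y
  proof -
    have "1 / 2 * (norm (x - p))\<^sup>2 + r + 1 / 2 * (norm (y - p))\<^sup>2 =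
        1 / 2 * (norm (x - y))\<^sup>2 + (r + inner (x - p) (y - p))"
      using norm_diff_scaled_sq[of x 1 p y] by (simp add: algebra_simps)
    then have "F p + ereal (1 / 2 * (norm (y - p))\<^sup>2) =
        ereal (1 / 2 * (norm (x - y))\<^sup>2) + ereal (r + inner (x - p) (y - p))"
      unfolding F_def r(1) by simp
    also have "\<dots> \<le> F y"
      unfolding F_def by (intro add_left_mono r(2))
    finally show ?thesis .
  qed
  have Fp: "\<bar>F p\<bar> \<noteq> \<infinity>"
    by (simp add: F_def r(1))
  have "is_arg_min F (\<lambda>_. True) = (\<lambda>q. q = p)"
  proof (intro ext iffI)
    fix q assume "is_arg_min F (\<lambda>_. True) q"
    then have "F q \<le> F p"
      by (auto simp: is_arg_min_def not_less)
    with strong[of q] have "F p + ereal (1 / 2 * (norm (q - p))\<^sup>2) \<le> F p"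
      by (rule order_trans)
    then have "(norm (q - p))\<^sup>2 \<le> 0"
      using Fp by (cases "F p") auto
    then show "q = p"
      by simp
  next
    fix q assume "q = p"
    moreover have "F p \<le> F y" for y
    proof -
      have "F p + 0 \<le> F p + ereal (1 / 2 * (norm (y - p))\<^sup>2)"
        by (intro add_left_mono) simp
      also have "\<dots> \<le> F y"
        by (rule strong)
      finally show ?thesis by simp
    qed
    ultimately show "is_arg_min F (\<lambda>_. True) q"
      by (simp add: is_arg_min_def not_less)
  qed
  then show ?thesis
    unfolding prox_def F_def[symmetric] by simp
qed

lemma subgradient_prox:
  fixes \<Phi> :: "'a::{real_inner, complete_space} \<Rightarrow> ereal"
  assumes "\<Phi> \<in> Gamma0 UNIV"
  shows "subgradient \<Phi> (prox \<Phi> x) (x - prox \<Phi> x)"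
proof -
  obtain p where "subgradient \<Phi> p (1 *\<^sub>R (x - p))"
    using resolvent_exists[OF assms, of 1] by auto
  then show ?thesis
    using prox_eqI by fastforce
qed

section \<open>The potential of the proximal map\<close>

text \<open>
  For \<open>\<Phi>\<close> in \<open>Gamma0 UNIV\<close> this is \<open>1 / 2 * (norm x)\<^sup>2\<close> minus the Moreau envelope of \<open>\<Phi>\<close> or, equivalently, the convex conjugate
  of \<open>\<lambda>y. \<Phi> y + 1 / 2 * (norm y)\<^sup>2\<close>; the supremum that defines the conjugate is attained at \<open>y = prox \<Phi> x\<close>.
\<close>

definition prox_potential :: "('a::real_inner \<Rightarrow> ereal) \<Rightarrow> 'a \<Rightarrow> real" where
  "prox_potential \<Phi> x =
    inner x (prox \<Phi> x) - 1 / 2 * (norm (prox \<Phi> x))\<^sup>2 - real_of_ereal (\<Phi> (prox \<Phi> x))"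

lemma prox_potential_eq:
  assumes "subgradient \<Phi> p (x - p)" "\<Phi> p = ereal r"
  shows "prox_potential \<Phi> x = inner x p - 1 / 2 * (norm p)\<^sup>2 - r"
  using prox_eqI[OF assms(1)] assms(2) by (simp add: prox_potential_def)

lemma Fenchel_Young:
  fixes \<Phi> :: "'a::{real_inner, complete_space} \<Rightarrow> ereal"
  assumes \<Phi>: "\<Phi> \<in> Gamma0 UNIV"
  shows "ereal (inner x y - prox_potential \<Phi> x - 1 / 2 * (norm y)\<^sup>2) \<le> \<Phi> y"
proof -
  define p where "p = prox \<Phi> x"
  have sub: "subgradient \<Phi> p (x - p)"
    using subgradient_prox[OF \<Phi>] by (simp add: p_def)
  then obtain r where r: "\<Phi> p = ereal r" "\<And>y. ereal (r + inner (x - p) (y - p)) \<le> \<Phi> y"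
    by (rule subgradientE) blast
  have "0 \<le> (norm (y - p))\<^sup>2"
    by simp
  then have "inner x y - prox_potential \<Phi> x - 1 / 2 * (norm y)\<^sup>2 \<le> r + inner (x - p) (y - p)"
    unfolding prox_potential_eq[OF sub r(1)] power2_norm_eq_inner
    by (simp add: inner_diff inner_commute algebra_simps)
  then show ?thesis
    using r(2)[of y] by (meson ereal_less_eq(3) order_trans)
qed

text \<open>
  By \<open>Fenchel_Young\<close> the potential is a supremum of affine functions. The one with slope \<open>prox \<Phi> x\<close>
  attains it at \<open>x\<close>, so \<open>prox \<Phi> x\<close> is a subgradient of the potential there.
\<close>

lemma prox_potential_gradient_le:
  fixes \<Phi> :: "'a::{real_inner, complete_space} \<Rightarrow> ereal"
  assumes \<Phi>: "\<Phi> \<in> Gamma0 UNIV"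
  shows "inner (y - x) (prox \<Phi> x) \<le> prox_potential \<Phi> y - prox_potential \<Phi> x"
proof -
  define p where "p = prox \<Phi> x"
  have sub: "subgradient \<Phi> p (x - p)"
    using subgradient_prox[OF \<Phi>] by (simp add: p_def)
  then obtain r where r: "\<Phi> p = ereal r"
    by (rule subgradientE)
  show ?thesis
    using Fenchel_Young[OF \<Phi>, of y p] r prox_potential_eq[OF sub r]
    by (simp add: p_def[symmetric] inner_diff)
qed

text \<open>
  Together with \<open>Fenchel_Young\<close> this says that \<open>\<Phi> y + 1 / 2 * (norm y)\<^sup>2\<close> is the supremum over \<open>x\<close>
  of \<open>inner x y - prox_potential \<Phi> x\<close>, which is biconjugation. Instead of separating the epigraph, take the point \<open>p\<close> with subgradient
  \<open>c *\<^sub>R (y - p)\<close>, which is the proximal point of \<open>x = p + c *\<^sub>R (y - p)\<close>. At this \<open>x\<close> the bound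
  for \<open>s\<close> equals
  \<open>\<Phi> p + (c - 1 / 2) * (norm (p - y))\<^sup>2\<close>. If \<open>p\<close> is near \<open>y\<close>, lower semicontinuity makes it exceed \<open>s\<close>;
  otherwise the quadratic term does, once \<open>c\<close> is large.
\<close>

lemma potential_approximates:
  fixes \<Phi> :: "'a::{real_inner, complete_space} \<Rightarrow> ereal"
  assumes \<Phi>: "\<Phi> \<in> Gamma0 UNIV" and s: "ereal s < \<Phi> y"
  obtains x where "s < inner x y - prox_potential \<Phi> x - 1 / 2 * (norm y)\<^sup>2"
proof -
  obtain d where d: "d > 0" "\<And>w. dist w y < d \<Longrightarrow> ereal s < \<Phi> w"
    using Gamma0_lsc[OF \<Phi> _ s] by (metis UNIV_I)
  obtain a b where ab: "b \<ge> 0" "\<And>w. ereal (a - b * norm (w - y)) \<le> \<Phi> w"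
    using Gamma0_linear_minorant[OF \<Phi>, where x = y] by metis
  \<comment> \<open>Chosen such that \<open>k * n\<^sup>2 \<ge> b * n + (\<bar>s - a\<bar> + 1)\<close> for all \<open>n \<ge> d\<close>; the summand \<open>1 / 2\<close> of \<open>c\<close>
    makes up for the quadratic term in the definition of the potential.\<close>
  define k where "k = (b + (\<bar>s - a\<bar> + 1) / d) / d"
  have k: "k \<ge> 0"
    using ab(1) d(1) by (simp add: k_def)
  define c where "c = k + 1 / 2"
  have c: "c > 0"
    using k by (simp add: c_def)
  obtain p where p: "subgradient \<Phi> p (c *\<^sub>R (y - p))"
    using resolvent_exists[OF \<Phi> c] .
  obtain r where r: "\<Phi> p = ereal r"
    using subgradientE[OF p] by metis
  define x where "x = p + c *\<^sub>R (y - p)"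
  have sub: "subgradient \<Phi> p (x - p)"
    using p by (simp add: x_def)
  have eq: "inner x y - prox_potential \<Phi> x - 1 / 2 * (norm y)\<^sup>2 = r + k * (norm (p - y))\<^sup>2"
    unfolding prox_potential_eq[OF sub r] unfolding x_def power2_norm_eq_inner c_def
    by (simp add: inner_diff inner_add inner_commute algebra_simps)
  have "s < r + k * (norm (p - y))\<^sup>2"
  proof (cases "norm (p - y) < d")
    case True
    have "s < r"
      using d(2)[of p] True r by (simp add: dist_norm)
    moreover have "0 \<le> k * (norm (p - y))\<^sup>2"
      using k by simp
    ultimately show ?thesis
      by linarith
  next
    case False
    define n where "n = norm (p - y)"
    have n: "n \<ge> d"
      using False by (simp add: n_def)
    have "k * n\<^sup>2 = (k * n) * n"
      by (simp add: power2_eq_square)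
    also have "\<dots> \<ge> (k * d) * n"
      using n d(1) k by (intro mult_right_mono mult_left_mono) auto
    also have "k * d = b + (\<bar>s - a\<bar> + 1) / d"
      using d(1) by (simp add: k_def)
    also have "\<dots> * n = b * n + (\<bar>s - a\<bar> + 1) / d * n"
      by (rule distrib_right)
    finally have "b * n + (\<bar>s - a\<bar> + 1) / d * n \<le> k * n\<^sup>2" .
    moreover have "(\<bar>s - a\<bar> + 1) / d * d \<le> (\<bar>s - a\<bar> + 1) / d * n"
      using n d(1) by (intro mult_left_mono) auto
    then have "\<bar>s - a\<bar> + 1 \<le> (\<bar>s - a\<bar> + 1) / d * n"
      using d(1) by simp
    moreover have "a - b * n \<le> r"
      using ab(2)[of p] r by (simp add: n_def)
    ultimately show ?thesis
      unfolding n_def[symmetric] by linarith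
  qed
  then show ?thesis
    using eq by (intro that[of x]) linarith
qed

text \<open>
  On each of \<open>n\<close> equal steps the increments of \<open>F\<close> and \<open>G\<close> lie between the same two bounds, which
  differ by the increment of \<open>a\<close> divided by \<open>n\<close>. These errors telescope to \<open>(a 1 - a 0) / n\<close>.
\<close>

lemma equal_slopes_imp_equal_increments:
  fixes F G a :: "real \<Rightarrow> real"
  assumes F: "\<And>s t. (s - t) * a t \<le> F s - F t"
    and G: "\<And>s t. (s - t) * a t \<le> G s - G t"
  shows "F 1 - F 0 = G 1 - G 0"
proof -
  have bound: "\<bar>(F 1 - F 0) - (G 1 - G 0)\<bar> \<le> (a 1 - a 0) / Suc n" for n
  proof -
    define N where "N = Suc n"
    define t where "t k = real k / real N" for k
    have step: "t (Suc k) - t k = 1 / N" for k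
      by (simp add: t_def diff_divide_distrib[symmetric])
    define D where "D k = F (t k) - G (t k)" for k
    have "\<bar>D (Suc k) - D k\<bar> \<le> (a (t (Suc k)) - a (t k)) / N" for k
    proof -
      have bwd: "t k - t (Suc k) = - (1 / N)"
        using step[of k] by linarith
      have "a (t k) / N \<le> F (t (Suc k)) - F (t k)" "F (t (Suc k)) - F (t k) \<le> a (t (Suc k)) / N"
          "a (t k) / N \<le> G (t (Suc k)) - G (t k)" "G (t (Suc k)) - G (t k) \<le> a (t (Suc k)) / N"
        using F[of "t (Suc k)" "t k", unfolded step] F[of "t k" "t (Suc k)", unfolded bwd]
          G[of "t (Suc k)" "t k", unfolded step] G[of "t k" "t (Suc k)", unfolded bwd]
        by simp_all
      then show ?thesis
        by (simp add: D_def diff_divide_distrib abs_le_iff)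
    qed
    then have "\<bar>\<Sum>k<N. D (Suc k) - D k\<bar> \<le> (\<Sum>k<N. (a (t (Suc k)) - a (t k)) / N)"
      by (intro order_trans[OF sum_abs] sum_mono)
    also have "\<dots> = (a (t N) - a (t 0)) / N"
      by (simp add: sum_divide_distrib[symmetric] sum_lessThan_telescope[where f = "\<lambda>k. a (t k)"])
    finally have "\<bar>D N - D 0\<bar> \<le> (a (t N) - a (t 0)) / N"
      by (simp add: sum_lessThan_telescope)
    then show ?thesis
      by (simp add: D_def t_def N_def algebra_simps)
  qed
  have "(\<lambda>n. (a 1 - a 0) / Suc n) \<longlonglongrightarrow> 0"
    by (rule LIMSEQ_Suc[OF lim_const_over_n])
  then have "\<bar>(F 1 - F 0) - (G 1 - G 0)\<bar> \<le> 0"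
    by (rule LIMSEQ_le_const) (use bound in blast)
  then show ?thesis
    by simp
qed

lemma prox_potential_increment:
  fixes \<Phi> :: "'a::{real_inner, complete_space} \<Rightarrow> ereal"
  assumes \<Phi>: "\<Phi> \<in> Gamma0 UNIV"
    and eq: "\<And>t. inner h (prox \<Phi> (x + t *\<^sub>R h)) = inner h (prox \<Phi> (y + t *\<^sub>R h))"
  shows "prox_potential \<Phi> (x + h) - prox_potential \<Phi> x =
    prox_potential \<Phi> (y + h) - prox_potential \<Phi> y"
proof -
  define a where "a t = inner h (prox \<Phi> (x + t *\<^sub>R h))" for t
  have "(s - t) * inner h (prox \<Phi> (z + t *\<^sub>R h)) \<le>
      prox_potential \<Phi> (z + s *\<^sub>R h) - prox_potential \<Phi> (z + t *\<^sub>R h)" for z s t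
  proof -
    have "(z + s *\<^sub>R h) - (z + t *\<^sub>R h) = (s - t) *\<^sub>R h"
      by (simp add: algebra_simps)
    then show ?thesis
      using prox_potential_gradient_le[OF \<Phi>, of "z + s *\<^sub>R h" "z + t *\<^sub>R h"] by simp
  qed
  from this[of _ _ x] this[of _ _ y]
  have "prox_potential \<Phi> (x + 1 *\<^sub>R h) - prox_potential \<Phi> (x + 0 *\<^sub>R h) =
      prox_potential \<Phi> (y + 1 *\<^sub>R h) - prox_potential \<Phi> (y + 0 *\<^sub>R h)"
    by (intro equal_slopes_imp_equal_increments[where a = a]) (simp_all add: a_def eq)
  then show ?thesis
    by simp
qed

section \<open>Orthogonal decompositions\<close>

locale orthogonal_blocks =
  fixes I :: "'i set" and M :: "'i \<Rightarrow> 'a::real_inner set"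
  assumes finite_index: "finite I"
    and subspace_block: "\<And>i. i \<in> I \<Longrightarrow> subspace (M i)"
    and orthogonal_block:
      "\<And>i j x y. i \<in> I \<Longrightarrow> j \<in> I \<Longrightarrow> i \<noteq> j \<Longrightarrow> x \<in> M i \<Longrightarrow> y \<in> M j \<Longrightarrow> inner x y = 0"
    and spanning: "subspace_sum I M = UNIV"
begin

abbreviation P :: "'i \<Rightarrow> 'a \<Rightarrow> 'a" where
  "P i \<equiv> orth_proj (M i)"

lemma inner_sum_block:
  assumes "i \<in> I" "\<And>j. j \<in> I \<Longrightarrow> h j \<in> M j" "v \<in> M i"
  shows "inner v (\<Sum>j\<in>I. h j) = inner v (h i)"
proof -
  have "inner v (\<Sum>j\<in>I. h j) = (\<Sum>j\<in>I. if j = i then inner v (h i) else 0)"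
    unfolding inner_sum_right using assms by (intro sum.cong) (auto simp: orthogonal_block)
  then show ?thesis
    using assms(1) finite_index by simp
qed

text \<open>
  The summands of a vector have the property that characterizes its orthogonal projections, so the
  projections exist by the decomposition itself.
\<close>

lemma proj_sum:
  assumes h: "\<And>j. j \<in> I \<Longrightarrow> h j \<in> M j" and i: "i \<in> I"
  shows "P i (\<Sum>j\<in>I. h j) = h i"
  unfolding orth_proj_def
proof (rule the_equality)
  have "inner v ((\<Sum>j\<in>I. h j) - h i) = 0" if "v \<in> M i" for v
    using inner_sum_block[OF i h that] by (simp add: inner_diff_right)
  then show "h i \<in> M i \<and> (\<Sum>j\<in>I. h j) - h i \<in> (M i)\<^sup>\<bottom>"
    using h[OF i] by (auto simp: orthogonal_comp_def orthogonal_def)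
next
  fix p assume p: "p \<in> M i \<and> (\<Sum>j\<in>I. h j) - p \<in> (M i)\<^sup>\<bottom>"
  then have d: "p - h i \<in> M i"
    using h[OF i] subspace_block[OF i] by (simp add: subspace_diff)
  then have "inner (p - h i) ((\<Sum>j\<in>I. h j) - p) = 0"
    using p by (auto simp: orthogonal_comp_def orthogonal_def)
  moreover have "inner (p - h i) (\<Sum>j\<in>I. h j) = inner (p - h i) (h i)"
    by (rule inner_sum_block[OF i h d])
  ultimately have "inner (p - h i) (p - h i) = 0"
    by (simp add: inner_diff_right)
  then show "p = h i"
    by simp
qed

lemma decompose:
  obtains h where "\<And>i. i \<in> I \<Longrightarrow> h i \<in> M i" "x = (\<Sum>i\<in>I. h i)"
  using spanning by (force simp: subspace_sum_def)

lemma proj_in: "i \<in> I \<Longrightarrow> P i x \<in> M i"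
  by (rule decompose[of x]) (metis proj_sum)

lemma sum_proj: "(\<Sum>i\<in>I. P i x) = x"
  by (rule decompose[of x]) (metis (mono_tags, lifting) proj_sum sum.cong)

lemma proj_add: "i \<in> I \<Longrightarrow> P i (x + y) = P i x + P i y"
  using proj_sum[of "\<lambda>i. P i x + P i y" i]
  by (simp add: sum.distrib sum_proj proj_in subspace_add subspace_block)

lemma proj_diff: "i \<in> I \<Longrightarrow> P i (x - y) = P i x - P i y"
  using proj_add[of i "x - y" y] by (simp add: eq_diff_eq)

lemma proj_block:
  assumes "i \<in> I" "j \<in> I" "x \<in> M i"
  shows "P j x = (if j = i then x else 0)"
proof -
  have "P j (\<Sum>k\<in>I. if k = i then x else 0) = (if j = i then x else 0)"
    using assms by (intro proj_sum) (auto simp: subspace_0 subspace_block)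
  then show ?thesis
    using assms finite_index by simp
qed

lemma inner_block: "i \<in> I \<Longrightarrow> v \<in> M i \<Longrightarrow> inner v x = inner v (P i x)"
  using inner_sum_block[of i "\<lambda>j. P j x" v] by (simp add: sum_proj proj_in)

lemma inner_proj: "inner x y = (\<Sum>i\<in>I. inner (P i x) (P i y))"
proof -
  have "inner x y = (\<Sum>i\<in>I. inner (P i x) y)"
    using inner_sum_left[of "\<lambda>i. P i x" I y] by (simp add: sum_proj)
  also have "\<dots> = (\<Sum>i\<in>I. inner (P i x) (P i y))"
    by (intro sum.cong refl inner_block proj_in)
  finally show ?thesis .
qed

lemma orth_proj_subspace_sum:
  assumes "A \<subseteq> I"
  shows "orth_proj (subspace_sum A M) x = (\<Sum>i\<in>A. P i x)"
  unfolding orth_proj_def[of "subspace_sum A M"]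
proof (rule the_equality)
  let ?h = "\<Sum>i\<in>A. P i x"
  have in_sum: "?h \<in> subspace_sum A M"
    unfolding subspace_sum_def using proj_in assms by blast
  have perp: "inner v (x - ?h) = 0" if v: "v \<in> subspace_sum A M" for v
  proof -
    obtain h where h: "\<And>i. i \<in> A \<Longrightarrow> h i \<in> M i" "v = (\<Sum>i\<in>A. h i)"
      using v by (auto simp: subspace_sum_def)
    have "x - ?h = (\<Sum>i\<in>I - A. P i x)"
      using sum_diff[OF finite_index assms, of "\<lambda>i. P i x"] by (simp add: sum_proj)
    moreover have "inner (h i) (P j x) = 0" if "i \<in> A" "j \<in> I - A" for i j
      using that assms h(1) by (intro orthogonal_block[of i j]) (auto simp: proj_in)
    ultimately show ?thesis
      unfolding h(2) inner_sum_left by (simp add: inner_sum_right)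
  qed
  show "?h \<in> subspace_sum A M \<and> x - ?h \<in> (subspace_sum A M)\<^sup>\<bottom>"
    using in_sum perp by (auto simp: orthogonal_comp_def orthogonal_def)
  fix p assume p: "p \<in> subspace_sum A M \<and> x - p \<in> (subspace_sum A M)\<^sup>\<bottom>"
  have "inner v (p - ?h) = 0" if "v \<in> subspace_sum A M" for v
    using perp[OF that] p that by (auto simp: orthogonal_comp_def orthogonal_def inner_diff_right)
  then have "inner p (p - ?h) = 0" "inner ?h (p - ?h) = 0"
    using p in_sum by blast+
  then have "inner (p - ?h) (p - ?h) = 0"
    by (simp add: inner_diff_left)
  then show "p = ?h"
    by simp
qed
end

section \<open>Block diagonal proximal maps and separable functions\<close>

lemma ereal_sum_not_MInfty:
  fixes f :: "'i \<Rightarrow> ereal"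
  assumes "\<And>i. i \<in> S \<Longrightarrow> f i \<noteq> - \<infinity>"
  shows "(\<Sum>i\<in>S. f i) \<noteq> - \<infinity>"
  using assms by (induction S rule: infinite_finite_induct) auto

text \<open>
  A sum of suprema is approximated by choosing near-maximal values separately in each summand,
  also if some of the suprema are infinite.
\<close>

lemma ereal_less_sum_split:
  fixes f :: "'i \<Rightarrow> ereal"
  assumes "finite S" "\<And>i. i \<in> S \<Longrightarrow> f i \<noteq> - \<infinity>" "ereal s < (\<Sum>i\<in>S. f i)"
  obtains t where "\<forall>i\<in>S. ereal (t i) < f i" "s \<le> (\<Sum>i\<in>S. t i)"
proof -
  have "\<exists>t. (\<forall>i\<in>S. ereal (t i) < f i) \<and> s \<le> (\<Sum>i\<in>S. t i)"
    using assms
  proof (induction S arbitrary: s rule: finite_induct)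
    case empty
    then show ?case by simp
  next
    case (insert i S)
    have ninf: "f i \<noteq> - \<infinity>" "(\<Sum>j\<in>S. f j) \<noteq> - \<infinity>"
      using insert.prems(1) by (blast, intro ereal_sum_not_MInfty) blast
    have less: "ereal s < f i + (\<Sum>j\<in>S. f j)"
      using insert by simp
    have "\<exists>a b. ereal a < f i \<and> ereal b < (\<Sum>j\<in>S. f j) \<and> s \<le> a + b"
    proof (cases "f i")
      case (real u)
      show ?thesis
      proof (cases "\<Sum>j\<in>S. f j")
        case (real v)
        with \<open>f i = ereal u\<close> less show ?thesis
          by (intro exI[of _ "u - (u + v - s) / 2"] exI[of _ "v - (u + v - s) / 2"])
            (simp add: field_simps)
      next
        case PInf
        with real show ?thesis
          by (intro exI[of _ "u - 1"] exI[of _ "s - u + 1"]) simp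
      qed (use ninf in simp)
    next
      case PInf
      obtain b where "ereal b < (\<Sum>j\<in>S. f j)"
        using ninf(2) by (metis ereal_dense2 ereal_infty_less(2))
      with PInf show ?thesis
        by (intro exI[of _ "s - b"] exI[of _ b]) simp
    qed (use ninf in simp)
    then obtain a b where ab: "ereal a < f i" "ereal b < (\<Sum>j\<in>S. f j)" "s \<le> a + b"
      by blast
    then obtain t where t: "\<forall>j\<in>S. ereal (t j) < f j" "b \<le> (\<Sum>j\<in>S. t j)"
      using insert.IH insert.prems(1) by (metis insertCI)
    have "(\<Sum>j\<in>S. (t(i := a)) j) = (\<Sum>j\<in>S. t j)"
      using insert.hyps(2) by (intro sum.cong) auto
    then show ?case
      using ab t insert.hyps by (intro exI[of _ "t(i := a)"]) auto
  qed
  then show ?thesis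
    using that by blast
qed

context orthogonal_blocks
begin

definition block_diagonal :: "('a \<Rightarrow> 'a) \<Rightarrow> bool" where
  "block_diagonal T \<longleftrightarrow> (\<forall>i\<in>I. \<forall>x y. P i x = P i y \<longrightarrow> P i (T x) = P i (T y))"

end

text \<open>
  Completeness of the ambient space enters through the existence of proximal points.
\<close>

locale complete_orthogonal_blocks = orthogonal_blocks I M
  for I :: "'i set" and M :: "'i \<Rightarrow> 'a::{real_inner, complete_space} set"
begin

text \<open>
  Moving by a vector \<open>h\<close> of the \<open>i\<close>-th block changes the potential at a rate \<open>inner h (prox \<Phi> _)\<close>, which
  sees only the \<open>i\<close>-th block of the proximal map, hence only the \<open>i\<close>-th block of the base point.
  The increment is therefore the same from the sum of the other blocks as from 0.
\<close>

lemma prox_potential_additive: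
  assumes \<Phi>: "\<Phi> \<in> Gamma0 UNIV" and T: "block_diagonal (prox \<Phi>)"
    and v: "\<And>i. i \<in> I \<Longrightarrow> v i \<in> M i"
  shows "prox_potential \<Phi> (\<Sum>i\<in>I. v i) - prox_potential \<Phi> 0 =
    (\<Sum>i\<in>I. prox_potential \<Phi> (v i) - prox_potential \<Phi> 0)"
proof -
  have "prox_potential \<Phi> (\<Sum>i\<in>S. v i) - prox_potential \<Phi> 0 =
      (\<Sum>i\<in>S. prox_potential \<Phi> (v i) - prox_potential \<Phi> 0)" if "S \<subseteq> I" for S
    using finite_subset[OF that finite_index] that
  proof (induction S rule: finite_induct)
    case (insert i S)
    let ?w = "\<Sum>j\<in>S. v j"
    have i: "i \<in> I"
      using insert.prems by simp
    have "P i ?w = 0"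
    proof -
      have "inner (P i ?w) ?w = 0"
        unfolding inner_sum_right
      proof (intro sum.neutral ballI)
        fix j assume "j \<in> S"
        then show "inner (P i ?w) (v j) = 0"
          using insert.hyps insert.prems v i by (intro orthogonal_block[of i j]) (auto simp: proj_in)
      qed
      then show ?thesis
        using inner_block[OF i proj_in[OF i], of ?w ?w] by simp
    qed
    then have "P i (?w + t *\<^sub>R v i) = P i (0 + t *\<^sub>R v i)" for t
      using i by (simp add: proj_add)
    then have "P i (prox \<Phi> (?w + t *\<^sub>R v i)) = P i (prox \<Phi> (0 + t *\<^sub>R v i))" for t
      using T i unfolding block_diagonal_def by blast
    then have "prox_potential \<Phi> (?w + v i) - prox_potential \<Phi> ?w =
        prox_potential \<Phi> (0 + v i) - prox_potential \<Phi> 0"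
      by (intro prox_potential_increment[OF \<Phi>]) (metis inner_block[OF i v[OF i]])
    then show ?case
      using insert by (simp add: add.commute)
  qed simp
  then show ?thesis
    by blast
qed

text \<open>
  Since the potential is a sum over the blocks, the supremum that recovers \<open>\<Phi>\<close> from it splits into
  independent suprema over the blocks.
\<close>

theorem block_diagonal_prox_imp_separable:
  assumes \<Phi>: "\<Phi> \<in> Gamma0 UNIV" and T: "block_diagonal (prox \<Phi>)"
  shows "\<exists>\<phi> C. (\<forall>i\<in>I. \<phi> i \<in> Gamma0 (M i)) \<and>
    (\<forall>x. \<Phi> x = ereal C + (\<Sum>i\<in>I. \<phi> i (P i x)))"
proof -
  define g where "g = prox_potential \<Phi>"
  define q where "q u v = inner u v - (g u - g 0) - 1 / 2 * (norm v)\<^sup>2" for u v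
  define \<phi> where "\<phi> i v = (SUP u\<in>M i. ereal (q u v))" for i v
  have not_minf: "\<phi> i v \<noteq> - \<infinity>" if "i \<in> I" for i v
  proof -
    have "ereal (q 0 v) \<le> \<phi> i v"
      unfolding \<phi>_def using that by (intro SUP_upper) (simp add: subspace_0 subspace_block)
    then show ?thesis by auto
  qed
  have split: "inner x y - g x - 1 / 2 * (norm y)\<^sup>2 = - g 0 + (\<Sum>i\<in>I. q (P i x) (P i y))" for x y
  proof -
    have "g x - g 0 = (\<Sum>i\<in>I. g (P i x) - g 0)"
      using prox_potential_additive[OF \<Phi> T, of "\<lambda>i. P i x"] by (simp add: g_def sum_proj proj_in)
    moreover have "(norm y)\<^sup>2 = (\<Sum>i\<in>I. (norm (P i y))\<^sup>2)"
      unfolding power2_norm_eq_inner by (rule inner_proj)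
    ultimately show ?thesis
      using inner_proj[of x y] by (simp add: q_def sum_subtractf sum_divide_distrib)
  qed
  have eq: "\<Phi> y = ereal (- g 0) + (\<Sum>i\<in>I. \<phi> i (P i y))" for y
  proof (rule antisym)
    show "\<Phi> y \<le> ereal (- g 0) + (\<Sum>i\<in>I. \<phi> i (P i y))"
    proof (rule ereal_le_real)
      show "\<Phi> y \<le> ereal z" if "ereal (- g 0) + (\<Sum>i\<in>I. \<phi> i (P i y)) \<le> ereal z" for z
      proof (rule ccontr)
        assume "\<not> \<Phi> y \<le> ereal z"
        then obtain x where x: "z < inner x y - g x - 1 / 2 * (norm y)\<^sup>2"
          using potential_approximates[OF \<Phi>] unfolding g_def by (metis not_le)
        have "ereal (\<Sum>i\<in>I. q (P i x) (P i y)) \<le> (\<Sum>i\<in>I. \<phi> i (P i y))"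
          unfolding sum_ereal[symmetric] \<phi>_def by (intro sum_mono SUP_upper proj_in)
        then have "ereal (- g 0) + ereal (\<Sum>i\<in>I. q (P i x) (P i y)) \<le> ereal z"
          using that by (meson add_left_mono order_trans)
        then show False
          using x split[of x y] by simp
      qed
    qed
    show "ereal (- g 0) + (\<Sum>i\<in>I. \<phi> i (P i y)) \<le> \<Phi> y"
    proof (rule ccontr)
      assume "\<not> ?thesis"
      then obtain s where s: "\<Phi> y < ereal s" "ereal s < ereal (- g 0) + (\<Sum>i\<in>I. \<phi> i (P i y))"
        by (metis ereal_dense2 not_le)
      then have less: "ereal (s + g 0) < (\<Sum>i\<in>I. \<phi> i (P i y))"
        by (cases "\<Sum>i\<in>I. \<phi> i (P i y)") auto
      obtain t where t: "\<forall>i\<in>I. ereal (t i) < \<phi> i (P i y)" "s + g 0 \<le> (\<Sum>i\<in>I. t i)"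
        using ereal_less_sum_split[OF finite_index not_minf less] .
      have "\<exists>u\<in>M i. t i < q u (P i y)" if "i \<in> I" for i
        using bspec[OF t(1) that] unfolding \<phi>_def less_SUP_iff by simp
      then obtain u where u: "\<And>i. i \<in> I \<Longrightarrow> u i \<in> M i" "\<And>i. i \<in> I \<Longrightarrow> t i < q (u i) (P i y)"
        by metis
      define x where "x = (\<Sum>i\<in>I. u i)"
      have "(\<Sum>i\<in>I. t i) \<le> (\<Sum>i\<in>I. q (P i x) (P i y))"
        unfolding x_def using u by (intro sum_mono) (simp add: proj_sum less_imp_le)
      then have "s \<le> inner x y - g x - 1 / 2 * (norm y)\<^sup>2"
        using t(2) split[of x y] by simp
      then have "ereal s \<le> \<Phi> y"
        using Fenchel_Young[OF \<Phi>, of x y] unfolding g_def by (meson ereal_less_eq(3) order_trans)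
      then show False
        using s(1) by simp
    qed
  qed
  obtain z r where z: "\<Phi> z = ereal r"
    using Gamma0_proper[OF \<Phi>] .
  have "(\<Sum>i\<in>I. \<phi> i (P i z)) \<noteq> \<infinity>"
    using eq[of z] z by auto
  then have fin: "\<bar>\<phi> i (P i z)\<bar> \<noteq> \<infinity>" if "i \<in> I" for i
    using not_minf that by (auto simp: sum_Pinfty finite_index)
  have "\<phi> i \<in> Gamma0 (M i)" if i: "i \<in> I" for i
  proof -
    \<comment> \<open>Freeze all blocks but the \<open>i\<close>-th at the point \<open>z\<close> of the domain.\<close>
    define w where "w = z - P i z"
    define k where "k = (\<Sum>j\<in>I - {i}. real_of_ereal (\<phi> j (P j z)))"
    have k: "ereal k = (\<Sum>j\<in>I - {i}. \<phi> j (P j z))"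
      unfolding k_def sum_ereal[symmetric] using fin by (intro sum.cong) (auto simp: ereal_real)
    show ?thesis
    proof (rule Gamma0_restrict_translate[OF \<Phi> subspace_block[OF i]])
      show "P i z \<in> M i" "\<Phi> (P i z + w) \<noteq> \<infinity>"
        using i z by (auto simp: proj_in w_def)
      fix v assume v: "v \<in> M i"
      have Pj: "P j (v + w) = (if j = i then v else P j z)" if "j \<in> I" for j
        using that i v by (auto simp: w_def proj_add proj_diff proj_block proj_in)
      have "\<Phi> (v + w) = ereal (- g 0) + (\<phi> i v + (\<Sum>j\<in>I - {i}. \<phi> j (P j z)))"
        unfolding eq sum.remove[OF finite_index i] using i
        by (intro arg_cong2[of _ _ _ _ "(+)"] refl sum.cong) (auto simp: Pj)
      then show "\<phi> i v = \<Phi> (v + w) + ereal (g 0 - k)"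
        unfolding k[symmetric] by (cases "\<phi> i v") auto
    qed
  qed
  with eq show ?thesis
    by blast
qed

text \<open>
  For a separable \<open>\<Phi>\<close> the \<open>i\<close>-th component of \<open>x - prox \<Phi> x\<close> is a subgradient of \<open>\<phi> i\<close> at the \<open>i\<close>-th component
  of \<open>prox \<Phi> x\<close>. If \<open>x\<close> and \<open>y\<close> share their \<open>i\<close>-th component, adding the two subgradient
  inequalities leaves the squared distance of the two proximal components bounded by 0.
\<close>

theorem separable_imp_block_diagonal_prox:
  assumes \<Phi>: "\<Phi> \<in> Gamma0 UNIV"
    and \<phi>: "\<And>i. i \<in> I \<Longrightarrow> \<phi> i \<in> Gamma0 (M i)"
    and eq: "\<And>x. \<Phi> x = ereal C + (\<Sum>i\<in>I. \<phi> i (P i x))"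
  shows "block_diagonal (prox \<Phi>)"
  unfolding block_diagonal_def
proof (intro ballI allI impI)
  have not_minf: "\<phi> i (P i x) \<noteq> - \<infinity>" if "i \<in> I" for i x
    using \<phi>[OF that] proj_in[OF that] by (auto simp: Gamma0_def)
  fix i x y assume i: "i \<in> I" and xy: "P i x = P i y"
  \<comment> \<open>Compare \<open>prox \<Phi> x\<close> with the point whose \<open>i\<close>-th component is moved to that of \<open>b\<close>.\<close>
  have block_subgradient: "\<exists>r. \<phi> i (P i (prox \<Phi> x)) = ereal r \<and>
      ereal (r + inner (P i x - P i (prox \<Phi> x)) (P i b - P i (prox \<Phi> x))) \<le> \<phi> i (P i b)" for x b
  proof -
    define p where "p = prox \<Phi> x"
    define p' where "p' = p + (P i b - P i p)"
    have d: "P i b - P i p \<in> M i"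
      using i by (simp add: proj_in subspace_diff subspace_block)
    obtain s where s: "\<Phi> p = ereal s" "\<And>y. ereal (s + inner (x - p) (y - p)) \<le> \<Phi> y"
      using subgradientE[OF subgradient_prox[OF \<Phi>, of x]] unfolding p_def by metis
    define R where "R = (\<Sum>j\<in>I - {i}. \<phi> j (P j p))"
    have \<Phi>p: "\<Phi> p = ereal C + (\<phi> i (P i p) + R)"
      unfolding eq[of p] sum.remove[OF finite_index i] R_def ..
    have Pj: "P j p' = (if j = i then P i b else P j p)" if "j \<in> I" for j
      using that i d by (auto simp: p'_def proj_add proj_block)
    have \<Phi>p': "\<Phi> p' = ereal C + (\<phi> i (P i b) + R)"
      unfolding eq[of p'] sum.remove[OF finite_index i] R_def using i
      by (intro arg_cong2[of _ _ _ _ "(+)"] refl sum.cong) (auto simp: Pj)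
    have "R \<noteq> - \<infinity>"
      unfolding R_def using not_minf by (intro ereal_sum_not_MInfty) auto
    then obtain r \<rho> where r: "\<phi> i (P i p) = ereal r" "R = ereal \<rho>"
      using \<Phi>p s(1) not_minf[OF i, of p] by (cases "\<phi> i (P i p)"; cases R) auto
    have "inner (x - p) (p' - p) = inner (P i x - P i p) (P i b - P i p)"
      using inner_block[OF i d, of "x - p"] i
      by (simp add: p'_def inner_commute proj_diff)
    then have "ereal (s + inner (P i x - P i p) (P i b - P i p)) \<le> ereal C + (\<phi> i (P i b) + ereal \<rho>)"
      using s(2)[of p'] \<Phi>p' r(2) by simp
    moreover have "s = C + r + \<rho>"
      using \<Phi>p s(1) r by simp
    ultimately have "ereal (r + inner (P i x - P i p) (P i b - P i p)) \<le> \<phi> i (P i b)"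
      by (cases "\<phi> i (P i b)") auto
    then show ?thesis
      using r(1) by (auto simp: p_def)
  qed
  define a b where "a = P i (prox \<Phi> x)" and "b = P i (prox \<Phi> y)"
  obtain r s where "\<phi> i a = ereal r" "\<phi> i b = ereal s"
      "r + inner (P i x - a) (b - a) \<le> s" "s + inner (P i x - b) (a - b) \<le> r"
    using block_subgradient[of x "prox \<Phi> y"] block_subgradient[of y "prox \<Phi> x"] xy
    by (auto simp: a_def b_def)
  then have "inner (a - b) (a - b) \<le> 0"
    by (simp add: inner_diff inner_commute algebra_simps)
  then have "inner (a - b) (a - b) = 0"
    using inner_ge_zero[of "a - b"] by linarith
  then show "P i (prox \<Phi> x) = P i (prox \<Phi> y)"
    by (simp add: a_def b_def)
qed

end

section \<open>Merging blocks\<close>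

lemma subspace_subspace_sum:
  assumes "\<And>i. i \<in> A \<Longrightarrow> subspace (M i)"
  shows "subspace (subspace_sum A M)"
proof (rule subspaceI)
  show "0 \<in> subspace_sum A M"
    unfolding subspace_sum_def using assms by (auto intro!: exI[of _ "\<lambda>_. 0"] simp: subspace_0)
next
  fix x y assume "x \<in> subspace_sum A M" "y \<in> subspace_sum A M"
  then obtain h k where "\<forall>i\<in>A. h i \<in> M i" "x = sum h A" "\<forall>i\<in>A. k i \<in> M i" "y = sum k A"
    by (auto simp: subspace_sum_def)
  then show "x + y \<in> subspace_sum A M"
    unfolding subspace_sum_def using assms
    by (auto intro!: exI[of _ "\<lambda>i. h i + k i"] simp: sum.distrib subspace_add)
next
  fix c x assume "x \<in> subspace_sum A M"
  then obtain h where "\<forall>i\<in>A. h i \<in> M i" "x = sum h A"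
    by (auto simp: subspace_sum_def)
  then show "c *\<^sub>R x \<in> subspace_sum A M"
    unfolding subspace_sum_def using assms
    by (auto intro!: exI[of _ "\<lambda>i. c *\<^sub>R h i"] simp: scaleR_sum_right subspace_scale)
qed

context orthogonal_blocks
begin

lemma orthogonal_blocks_merge:
  assumes Cs: "disjoint Cs" "\<Union>Cs = I"
  shows "orthogonal_blocks Cs (\<lambda>A. subspace_sum A M)"
proof
  have sub: "A \<subseteq> I" if "A \<in> Cs" for A
    using that Cs(2) by blast
  show "finite Cs"
    using finite_index Cs(2) finite_UnionD by metis
  show "subspace (subspace_sum A M)" if "A \<in> Cs" for A
    using sub[OF that] by (intro subspace_subspace_sum subspace_block) blast
  show "inner x y = 0" if AB: "A \<in> Cs" "B \<in> Cs" "A \<noteq> B"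
    and x: "x \<in> subspace_sum A M" and y: "y \<in> subspace_sum B M" for A B x y
  proof -
    obtain h where h: "\<forall>i\<in>A. h i \<in> M i" "x = sum h A"
      using x by (auto simp: subspace_sum_def)
    obtain k where k: "\<forall>i\<in>B. k i \<in> M i" "y = sum k B"
      using y by (auto simp: subspace_sum_def)
    have "A \<inter> B = {}"
      using AB Cs(1) by (simp add: disjoint_def)
    then have "inner (h i) (k j) = 0" if "i \<in> A" "j \<in> B" for i j
      using that h(1) k(1) sub[OF AB(1)] sub[OF AB(2)] by (intro orthogonal_block[of i j]) blast+
    then show ?thesis
      unfolding h(2) k(2) by (simp add: inner_sum_left inner_sum_right)
  qed
  show "subspace_sum Cs (\<lambda>A. subspace_sum A M) = UNIV"
  proof -
    have "x \<in> subspace_sum Cs (\<lambda>A. subspace_sum A M)" for x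
    proof -
      have "x = (\<Sum>i\<in>\<Union>Cs. P i x)"
        by (simp add: Cs(2) sum_proj)
      also have "\<dots> = (\<Sum>A\<in>Cs. \<Sum>i\<in>A. P i x)"
        using sub finite_subset[OF _ finite_index] Cs(1)
        by (subst sum.Union_disjoint) (auto simp: disjoint_def)
      finally have "x = (\<Sum>A\<in>Cs. \<Sum>i\<in>A. P i x)" .
      moreover have "\<forall>A\<in>Cs. (\<Sum>i\<in>A. P i x) \<in> subspace_sum A M"
        using sub unfolding subspace_sum_def by (blast intro: proj_in)
      ultimately show ?thesis
        unfolding subspace_sum_def[of Cs] by blast
    qed
    then show ?thesis
      by blast
  qed
qed

text \<open>
  If \<open>x\<close> and \<open>y\<close> agree on the merged block then they differ by a finite sum of vectors from the
  other blocks. Adding these one at a time never changes the components of \<open>T\<close> in \<open>A\<close>.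
\<close>

lemma indep_imp_block_depends_only_on_block:
  assumes A: "A \<subseteq> I"
    and indep: "\<And>i j. i \<in> I - A \<Longrightarrow> j \<in> A \<Longrightarrow> indep_of T (M i) (M j)"
    and xy: "orth_proj (subspace_sum A M) x = orth_proj (subspace_sum A M) y"
  shows "orth_proj (subspace_sum A M) (T x) = orth_proj (subspace_sum A M) (T y)"
proof -
  have P_sum: "P i (\<Sum>j\<in>A. P j z) = (if i \<in> A then P i z else 0)" if "i \<in> I" for i z
  proof -
    have "(\<Sum>j\<in>A. P j z) = (\<Sum>j\<in>I. if j \<in> A then P j z else 0)"
      using A finite_index by (simp add: sum.inter_restrict[symmetric] Int_absorb1)
    moreover have "P i (\<Sum>j\<in>I. if j \<in> A then P j z else 0) = (if i \<in> A then P i z else 0)"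
      using that by (intro proj_sum) (auto simp: proj_in subspace_0 subspace_block)
    ultimately show ?thesis
      by simp
  qed
  have "P i x = P i y" if "i \<in> A" for i
    using P_sum[of i x] P_sum[of i y] that A xy unfolding orth_proj_subspace_sum[OF A] by auto
  then have "(\<Sum>i\<in>I. P i (x - y)) = (\<Sum>i\<in>I - A. P i (x - y))"
    using A by (intro sum.mono_neutral_right finite_index) (auto simp: proj_diff)
  then have x: "x = y + (\<Sum>i\<in>I - A. P i (x - y))"
    by (simp add: sum_proj)
  have "P j (T (y + (\<Sum>i\<in>S. P i (x - y)))) = P j (T y)" if "S \<subseteq> I - A" "j \<in> A" for S j
    using finite_subset[OF that(1)] finite_index that
  proof (induction S rule: infinite_finite_induct)
    case (insert i S)
    have "P j (T (y + (\<Sum>i\<in>S. P i (x - y)) + P i (x - y))) = P j (T (y + (\<Sum>i\<in>S. P i (x - y))))"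
      using indep[of i j] insert.prems proj_in[of i "x - y"] by (auto simp: indep_of_def)
    then show ?case
      using insert by (simp add: add_ac)
  qed auto
  from this[of "I - A"] have "P j (T x) = P j (T y)" if "j \<in> A" for j
    using that x by simp
  then show ?thesis
    unfolding orth_proj_subspace_sum[OF A] by (intro sum.cong) auto
qed

end

section \<open>Components of the dependency graph\<close>

text \<open>
  The vertices \<open>i\<close> and \<open>j\<close> of an arc of the symmetrized digraph reach each other, hence lie in the
  same component.
\<close>

lemma dependency_components_props:
  fixes T :: "'a::real_inner \<Rightarrow> 'a"
  shows disjoint_dependency_components: "disjoint (dependency_components m H T)"
    and Union_dependency_components: "\<Union>(dependency_components m H T) = {1..m}"
    and indep_of_outside_component: "A \<in> dependency_components m H T \<Longrightarrow>
      i \<in> {1..m} - A \<Longrightarrow> j \<in> A \<Longrightarrow> indep_of T (H i) (H j)"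
proof -
  let ?D = "with_proj (dependency_digraph m H T)"
  have "wf_digraph ?D"
    by unfold_locales (auto simp: dependency_digraph_def)
  then interpret S: pair_wf_digraph "mk_symmetric ?D"
    by (rule wf_digraph.wellformed_mk_symmetric)
  have Cs: "dependency_components m H T = S.sccs_verts"
    by (simp add: dependency_components_def)
  have verts: "pverts (mk_symmetric ?D) = {1..m}"
    by (simp add: dependency_digraph_def)
  show "disjoint (dependency_components m H T)"
    unfolding Cs disjoint_def using S.sccs_verts_disjoint by blast
  show Un: "\<Union>(dependency_components m H T) = {1..m}"
  proof
    show "\<Union>(dependency_components m H T) \<subseteq> {1..m}"
      unfolding Cs using S.sccs_verts_subsets verts by auto
    show "{1..m} \<subseteq> \<Union>(dependency_components m H T)"
    proof
      fix u assume "u \<in> {1..m}"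
      then have "u \<in> pverts (mk_symmetric ?D)"
        by (simp only: verts)
      then show "u \<in> \<Union>(dependency_components m H T)"
        unfolding Cs using S.scc_of_in_sccs_verts[of u] S.in_scc_of_self[of u] by auto
    qed
  qed
  assume A: "A \<in> dependency_components m H T" and i: "i \<in> {1..m} - A" and j: "j \<in> A"
  show "indep_of T (H i) (H j)"
  proof (rule ccontr)
    assume "\<not> ?thesis"
    moreover have "j \<in> {1..m}"
      using A j Un by blast
    ultimately have "(i, j) \<in> parcs (dependency_digraph m H T)"
      using i j by (auto simp: dependency_digraph_def)
    then have "(i, j) \<in> arcs ?D"
      by simp
    then have "(i, j) \<in> parcs (mk_symmetric ?D)"
      unfolding parcs_mk_symmetric by (rule UN_I) simp
    moreover have "(j, i) \<in> parcs (mk_symmetric ?D)"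
      using \<open>(i, j) \<in> arcs ?D\<close> unfolding parcs_mk_symmetric by (rule UN_I) simp
    ultimately have "i \<rightarrow>\<^sup>*\<^bsub>mk_symmetric ?D\<^esub> j" "j \<rightarrow>\<^sup>*\<^bsub>mk_symmetric ?D\<^esub> i"
      by auto
    then show False
      using A i j unfolding Cs S.sccs_verts_def by blast
  qed
qed

theorem theorem3p7:
  fixes m :: nat
    and H :: "nat \<Rightarrow> 'a::{real_inner, complete_space} set"
    and \<Phi> :: "'a \<Rightarrow> ereal"
    and Cs :: "nat set set"
    and K :: "nat set \<Rightarrow> 'a set"
  assumes "orth_decomposition m H"
    and "\<Phi> \<in> Gamma0 UNIV"
    and "Cs = dependency_components m H (prox \<Phi>)"
    and "\<And>A. K A = subspace_sum A H"
  shows "(\<exists>(\<phi> :: nat set \<Rightarrow> 'a \<Rightarrow> ereal) (C :: real).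
            (\<forall>A\<in>Cs. \<phi> A \<in> Gamma0 (K A)) \<and>
            (\<forall>x. \<Phi> x = ereal C + (\<Sum>A\<in>Cs. \<phi> A (orth_proj (K A) x))))
       \<and> (\<forall>(\<phi> :: nat set \<Rightarrow> 'a \<Rightarrow> ereal) (C :: real).
            (\<forall>A\<in>Cs. \<phi> A \<in> Gamma0 (K A)) \<and>
            (\<forall>x. \<Phi> x = ereal C + (\<Sum>A\<in>Cs. \<phi> A (orth_proj (K A) x))) \<longrightarrow>
            (\<forall>A\<in>Cs. \<forall>x y. orth_proj (K A) x = orth_proj (K A) y \<longrightarrow>
               orth_proj (K A) (prox \<Phi> x) = orth_proj (K A) (prox \<Phi> y)))"
proof -
  interpret H: orthogonal_blocks "{1..m}" H
    using assms(1) by unfold_locales (auto simp: orth_decomposition_def orthogonal_def)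
  have K: "K = (\<lambda>A. subspace_sum A H)"
    using assms(4) by blast
  have Cs: "disjoint Cs" "\<Union>Cs = {1..m}"
    unfolding assms(3) by (rule disjoint_dependency_components Union_dependency_components)+
  interpret K: complete_orthogonal_blocks Cs K
    unfolding K complete_orthogonal_blocks_def by (rule H.orthogonal_blocks_merge[OF Cs])
  have "K.block_diagonal (prox \<Phi>)"
    unfolding K.block_diagonal_def unfolding K
  proof (intro ballI allI impI)
    fix A x y
    assume A: "A \<in> Cs" and xy: "orth_proj (subspace_sum A H) x = orth_proj (subspace_sum A H) y"
    have "A \<subseteq> {1..m}"
      using A Cs(2) by blast
    then show "orth_proj (subspace_sum A H) (prox \<Phi> x) = orth_proj (subspace_sum A H) (prox \<Phi> y)"
    proof (rule H.indep_imp_block_depends_only_on_block[OF _ _ xy])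
      show "indep_of (prox \<Phi>) (H i) (H j)" if "i \<in> {1..m} - A" "j \<in> A" for i j
        using A that unfolding assms(3) by (rule indep_of_outside_component)
    qed
  qed
  note separable = K.block_diagonal_prox_imp_separable[OF assms(2) this]
  show ?thesis
  proof (intro conjI allI impI)
    show "\<exists>(\<phi> :: nat set \<Rightarrow> 'a \<Rightarrow> ereal) (C :: real). (\<forall>A\<in>Cs. \<phi> A \<in> Gamma0 (K A)) \<and>
        (\<forall>x. \<Phi> x = ereal C + (\<Sum>A\<in>Cs. \<phi> A (orth_proj (K A) x)))"
      by (rule separable)
  next
    fix \<phi> :: "nat set \<Rightarrow> 'a \<Rightarrow> ereal" and C :: real
    assume "(\<forall>A\<in>Cs. \<phi> A \<in> Gamma0 (K A)) \<and>
      (\<forall>x. \<Phi> x = ereal C + (\<Sum>A\<in>Cs. \<phi> A (orth_proj (K A) x)))"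
    then have "K.block_diagonal (prox \<Phi>)"
      by (intro K.separable_imp_block_diagonal_prox[OF assms(2), of \<phi> C]) blast+
    then show "\<forall>A\<in>Cs. \<forall>x y. orth_proj (K A) x = orth_proj (K A) y \<longrightarrow>
        orth_proj (K A) (prox \<Phi> x) = orth_proj (K A) (prox \<Phi> y)"
      by (simp only: K.block_diagonal_def)
  qed
qed

end
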